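(* If $G$ is a thrifty connected graph with diameter $d$, then $c_r(G)=2^d$.
   Context: A pebbling distribution assigns to each vertex a non-negative integer number of pebbles; a rooted distribution fixes a root $r$. A pebbling step $[a,b]$, for adjacent $a,b$, removes two pebbles from $a$ and adds one to $b$; it is greedy if $d(a,r)>d(b,r)$ ($d$ = graph distance). A rooted distribution is $r$-solvable if some sequence of pebbling steps (a solution) ends with at least one pebble on $r$; it is $r$-critical if it is $r$-solvable but removing any single pebble makes it not $r$-solvable; it is greedy if it has a solution using only greedy steps. $c_r(G)$ is the largest size of an $r$-critical rooted distribution on $G$ over all roots $r$; an $r$-ceiling distribution is an $r$-critical rooted distribution (any root) with exactly $c_r(G)$ pebbles. $G$ is thrifty if every $r$-ceiling distribution on $G$ is greedy. *)

theory Defs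
  imports "Graph_Theory.Digraph_Component" "Graph_Theory.Shortest_Path" "HOL-Library.Multiset"
begin

(* A finite simple graph is an instance of the locale graph: a finite, symmetric, loop-free
   digraph without parallel arcs, so that every undirected edge ab is a pair of arcs. *)

definition graph_dist :: "('v, 'e) pre_digraph \<Rightarrow> 'v \<Rightarrow> 'v \<Rightarrow> nat" where
  "graph_dist G u v = (LEAST n. \<exists>p. pre_digraph.awalk G u p v \<and> length p = n)"

definition graph_diameter :: "('v, 'e) pre_digraph \<Rightarrow> nat" where
  "graph_diameter G = Max {graph_dist G u v | u v. u \<in> verts G \<and> v \<in> verts G}"

(* graph_dist is the library's shortest-path cost for unit arc costs. *)
lemma (in wf_digraph) mu_unit_eq_graph_dist:
  assumes "u \<rightarrow>\<^sup>*\<^bsub>G\<^esub> v"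
  shows "\<mu> (\<lambda>_. 1) u v = ereal (real (graph_dist G u v))"
proof -
  have cost: "awalk_cost (\<lambda>_. 1) p = real (length p)" for p
    by (induction p) simp_all
  have "\<exists>n p. awalk u p v \<and> length p = n"
    using assms by (auto simp: reachable_awalk)
  then have "\<exists>p. awalk u p v \<and> length p = graph_dist G u v"
    unfolding graph_dist_def by (rule LeastI_ex)
  then obtain q where q: "awalk u q v" "length q = graph_dist G u v" by blast
  have least: "graph_dist G u v \<le> length p" if "awalk u p v" for p
    unfolding graph_dist_def using that by (blast intro: Least_le)
  show ?thesis
    unfolding \<mu>_def
  proof (rule antisym)
    show "(INF p\<in>{p. awalk u p v}. ereal (awalk_cost (\<lambda>_. 1) p)) \<le> ereal (real (graph_dist G u v))"
      using q by (auto simp: cost intro!: INF_lower2[of q])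
    show "ereal (real (graph_dist G u v)) \<le> (INF p\<in>{p. awalk u p v}. ereal (awalk_cost (\<lambda>_. 1) p))"
      using least by (auto simp: cost intro!: INF_greatest)
  qed
qed

(* A pebbling distribution is a multiset D of vertices: count D v is the number of pebbles on v,
   and size D is the total number of pebbles. *)

definition rooted_distribution :: "('v, 'e) pre_digraph \<Rightarrow> 'v \<Rightarrow> 'v multiset \<Rightarrow> bool" where
  "rooted_distribution G r D \<longleftrightarrow> r \<in> verts G \<and> set_mset D \<subseteq> verts G"

definition pebbling_step ::
    "('v, 'e) pre_digraph \<Rightarrow> 'v \<times> 'v \<Rightarrow> 'v multiset \<Rightarrow> 'v multiset \<Rightarrow> bool" where
  "pebbling_step G s D D' \<longleftrightarrow>
     (case s of (a, b) \<Rightarrow> a \<rightarrow>\<^bsub>G\<^esub> b \<and> count D a \<ge> 2 \<and> D' = D - {#a, a#} + {#b#})"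

inductive pebbling_sequence ::
    "('v, 'e) pre_digraph \<Rightarrow> 'v multiset \<Rightarrow> ('v \<times> 'v) list \<Rightarrow> 'v multiset \<Rightarrow> bool"
  for G where
  Nil: "pebbling_sequence G D [] D"
| Cons: "pebbling_step G s D D' \<Longrightarrow> pebbling_sequence G D' ss D'' \<Longrightarrow>
         pebbling_sequence G D (s # ss) D''"

definition solution ::
    "('v, 'e) pre_digraph \<Rightarrow> 'v \<Rightarrow> 'v multiset \<Rightarrow> ('v \<times> 'v) list \<Rightarrow> bool" where
  "solution G r D ss \<longleftrightarrow> (\<exists>D'. pebbling_sequence G D ss D' \<and> count D' r \<ge> 1)"

definition solvable :: "('v, 'e) pre_digraph \<Rightarrow> 'v \<Rightarrow> 'v multiset \<Rightarrow> bool" where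
  "solvable G r D \<longleftrightarrow> (\<exists>ss. solution G r D ss)"

definition critical :: "('v, 'e) pre_digraph \<Rightarrow> 'v \<Rightarrow> 'v multiset \<Rightarrow> bool" where
  "critical G r D \<longleftrightarrow> solvable G r D \<and> (\<forall>v. v \<in># D \<longrightarrow> \<not> solvable G r (D - {#v#}))"

definition greedy_step :: "('v, 'e) pre_digraph \<Rightarrow> 'v \<Rightarrow> 'v \<times> 'v \<Rightarrow> bool" where
  "greedy_step G r s \<longleftrightarrow> (case s of (a, b) \<Rightarrow> graph_dist G a r > graph_dist G b r)"

definition greedy :: "('v, 'e) pre_digraph \<Rightarrow> 'v \<Rightarrow> 'v multiset \<Rightarrow> bool" where
  "greedy G r D \<longleftrightarrow> (\<exists>ss. solution G r D ss \<and> (\<forall>s \<in> set ss. greedy_step G r s))"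

(* For finite connected nonempty G the set is nonempty (a single pebble on the root is critical)
   and finite (2 ^ d(v,r) pebbles on v alone are solvable, so a critical distribution
   has at most that many pebbles on v). *)
definition critical_number :: "('v, 'e) pre_digraph \<Rightarrow> nat" where
  "critical_number G = Max {size D | r D. rooted_distribution G r D \<and> critical G r D}"

definition ceiling_distribution :: "('v, 'e) pre_digraph \<Rightarrow> 'v \<Rightarrow> 'v multiset \<Rightarrow> bool" where
  "ceiling_distribution G r D \<longleftrightarrow>
     rooted_distribution G r D \<and> critical G r D \<and> size D = critical_number G"

definition thrifty :: "('v, 'e) pre_digraph \<Rightarrow> bool" where
  "thrifty G \<longleftrightarrow> (\<forall>r D. ceiling_distribution G r D \<longrightarrow> greedy G r D)"

end

(* Scale the usual weight so that a pebble on v counts 2 ^ (d - dist(v, r)).  A pebbling step never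
   increases the total weight and a greedy step preserves it, so solvable distributions weigh at
   least 2 ^ d.  Hence 2 ^ d pebbles at distance d from r form a critical distribution.  Conversely,
   tracing a greedy solution back from one pebble on the root yields a solvable subdistribution of
   weight exactly 2 ^ d; by criticality it is everything, and every pebble weighs at least 1. *)
theory Submission
  imports Defs
begin

section \<open>Monotonicity of solvability\<close>

lemma solvable_root: "r \<in># D \<Longrightarrow> solvable G r D"
  unfolding solvable_def solution_def
  by (rule exI[of _ "[]"]) (auto intro: pebbling_sequence.Nil)

lemma solvable_step:
  assumes "pebbling_step G s D D'" "solvable G r D'"
  shows "solvable G r D"
  using assms unfolding solvable_def solution_def by (blast intro: pebbling_sequence.Cons)

lemma pebbling_step_mono:
  assumes "pebbling_step G s D D'"
  shows "pebbling_step G s (D + M) (D' + M)"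
proof -
  obtain a b where s: "s = (a, b)" by force
  \<comment> \<open>Multiset difference truncates; this containment lets it commute with adding
    \<open>M\<close>.\<close>
  have "{#a, a#} \<subseteq># D"
    using assms by (auto simp: s pebbling_step_def subseteq_mset_def)
  then show ?thesis
    using assms by (auto simp: s pebbling_step_def subset_mset.add_diff_assoc2)
qed

lemma pebbling_sequence_mono:
  assumes "pebbling_sequence G D ss D'"
  shows "pebbling_sequence G (D + M) ss (D' + M)"
  using assms
  by induction (auto intro: pebbling_sequence.intros pebbling_step_mono)

lemma solvable_mono:
  assumes "solvable G r D" "D \<subseteq># E"
  shows "solvable G r E"
proof -
  obtain ss D' where "pebbling_sequence G D ss D'" "count D' r \<ge> 1"
    using assms(1) unfolding solvable_def solution_def by blast
  moreover obtain M where "E = D + M" using assms(2) by (auto simp: subset_mset.le_iff_add)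
  ultimately have "pebbling_sequence G E ss (D' + M)" "count (D' + M) r \<ge> 1"
    using pebbling_sequence_mono by (blast, simp add: trans_le_add1)
  then show ?thesis unfolding solvable_def solution_def by blast
qed

text \<open>Two pebbles on \<open>a\<close> pay for each one wanted on \<open>b\<close>. The
  induction varies \<open>M\<close> because a pebble already moved to \<open>b\<close> joins the
  bystanders.\<close>

lemma solvable_move_along_arc:
  assumes "a \<rightarrow>\<^bsub>G\<^esub> b" "solvable G r (replicate_mset n b + M)"
  shows "solvable G r (replicate_mset (2 * n) a + M)"
  using assms(2)
proof (induction n arbitrary: M)
  case (Suc n)
  have "solvable G r (replicate_mset (2 * n) a + add_mset b M)"
    using Suc.IH[of "add_mset b M"] Suc.prems by simp
  moreover have "pebbling_step G (a, b) (replicate_mset (2 * Suc n) a + M)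
      (replicate_mset (2 * n) a + add_mset b M)"
    using assms(1) by (simp add: pebbling_step_def)
  ultimately show ?case by (rule solvable_step[rotated])
qed simp

text \<open>Criticality speaks of removing one pebble only. If \<open>E\<close> were smaller, it
  would still fit into \<open>D\<close> without some surplus pebble, and monotonicity would make
  that remainder solvable.\<close>

lemma critical_subset_eq:
  assumes "critical G r D" "solvable G r E" "E \<subseteq># D"
  shows "E = D"
proof (rule ccontr)
  assume "E \<noteq> D"
  moreover obtain F where F: "D = E + F" using assms(3) by (auto simp: subset_mset.le_iff_add)
  ultimately obtain v A where "F = add_mset v A"
    by (metis add.right_neutral multi_nonempty_split)
  with F have "v \<in># D" and "E \<subseteq># D - {#v#}" by auto
  moreover from this have "solvable G r (D - {#v#})" using solvable_mono[OF assms(2)] by blast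
  ultimately show False
    using assms(1) by (simp add: critical_def)
qed

section \<open>Distances, diameter and weight in a connected graph\<close>

locale connected_graph = graph +
  assumes connected_graph: "Digraph_Component.connected G"
begin

abbreviation dist where "dist \<equiv> graph_dist G"
abbreviation diam where "diam \<equiv> graph_diameter G"

text \<open>The factor \<open>2 ^ diam\<close> keeps the weights in the naturals. On vertices of
  \<open>G\<close> the subtraction never truncates, by \<open>dist_le_diam\<close> below; any other
  pebble still counts at least 1.\<close>

definition weight :: "'a \<Rightarrow> 'a multiset \<Rightarrow> nat" where
  "weight r D = (\<Sum>v\<in>#D. 2 ^ (diam - dist v r))"

lemma verts_nonempty: "verts G \<noteq> {}"
  using connected_graph by (auto simp: connected_def strongly_connected_def)

text \<open>Connectedness is defined through the symmetrised digraph, whose reachability agrees with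
  that of \<open>G\<close> since the arcs are symmetric.\<close>

lemma reachable_verts:
  assumes "u \<in> verts G" "v \<in> verts G"
  shows "u \<rightarrow>\<^sup>*\<^bsub>G\<^esub> v"
  using assms connected_graph reachable_mk_symmetric_eq[OF sym_arcs]
  by (auto simp: connected_def strongly_connected_def)

lemma shortest_awalk:
  assumes "u \<in> verts G" "v \<in> verts G"
  obtains p where "awalk u p v" "length p = dist u v"
proof -
  have "\<exists>n p. awalk u p v \<and> length p = n"
    using reachable_verts[OF assms] by (auto simp: reachable_awalk)
  then have "\<exists>p. awalk u p v \<and> length p = dist u v"
    unfolding graph_dist_def by (rule LeastI_ex)
  then show thesis using that by blast
qed

lemma dist_le_length: "awalk u p v \<Longrightarrow> dist u v \<le> length p"
  unfolding graph_dist_def by (blast intro: Least_le)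

lemma dist_self: "u \<in> verts G \<Longrightarrow> dist u u = 0"
  using dist_le_length[of u "[]" u] by (simp add: awalk_Nil_iff)

text \<open>The arc can be prepended to a shortest walk from \<open>b\<close>. This is what limits
  the gain in weight of a single step.\<close>

lemma dist_arc:
  assumes "a \<rightarrow>\<^bsub>G\<^esub> b" "r \<in> verts G"
  shows "dist a r \<le> Suc (dist b r)"
proof -
  obtain e where e: "e \<in> arcs G" "tail G e = a" "head G e = b"
    using assms(1) by auto
  then have "b \<in> verts G" by auto
  then obtain p where p: "awalk b p r" "length p = dist b r"
    using shortest_awalk assms(2) by blast
  then have "awalk a (e # p) r" using e by (auto simp: awalk_Cons_iff)
  from dist_le_length[OF this] p(2) show ?thesis by simp
qed

lemma finite_dists: "finite {dist u v |u v. u \<in> verts G \<and> v \<in> verts G}"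
proof -
  have "{dist u v |u v. u \<in> verts G \<and> v \<in> verts G} = (\<lambda>(u, v). dist u v) ` (verts G \<times> verts G)"
    by auto
  then show ?thesis by simp
qed

lemma dist_le_diam: "u \<in> verts G \<Longrightarrow> v \<in> verts G \<Longrightarrow> dist u v \<le> diam"
  unfolding graph_diameter_def by (rule Max_ge[OF finite_dists]) auto

lemma diam_attained:
  obtains u v where "u \<in> verts G" "v \<in> verts G" "dist u v = diam"
proof -
  have "diam \<in> {dist u v |u v. u \<in> verts G \<and> v \<in> verts G}"
    unfolding graph_diameter_def using verts_nonempty by (intro Max_in[OF finite_dists]) auto
  then show thesis using that by auto
qed

section \<open>Stacks on a single vertex\<close>

lemma solvable_awalk:
  assumes "awalk u p r"
  shows "solvable G r (replicate_mset (2 ^ length p) u)"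
  using assms
proof (induction p arbitrary: u)
  case Nil
  then show ?case by (auto simp: awalk_Nil_iff intro: solvable_root)
next
  case (Cons e p)
  have "u \<rightarrow>\<^bsub>G\<^esub> head G e"
    using Cons.prems by (auto simp: awalk_Cons_iff in_arcs_imp_in_arcs_ends)
  \<comment> \<open>Crossing the first arc halves the stack, leaving the power of two that the rest
    of the walk needs.\<close>
  with solvable_move_along_arc[of u "head G e" G r "2 ^ length p" "{#}"]
  show ?case using Cons by (simp add: awalk_Cons_iff)
qed

lemma solvable_replicate:
  assumes "u \<in> verts G" "r \<in> verts G"
  shows "solvable G r (replicate_mset (2 ^ dist u r) u)"
  using shortest_awalk[OF assms] solvable_awalk by metis

section \<open>Weight under pebbling steps\<close>

lemma weight_arc_le:
  assumes "a \<rightarrow>\<^bsub>G\<^esub> b" "r \<in> verts G"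
  shows "(2::nat) ^ (diam - dist b r) \<le> 2 * 2 ^ (diam - dist a r)"
proof -
  have "diam - dist b r \<le> Suc (diam - dist a r)"
    using dist_arc[OF assms] by linarith
  from power_increasing[OF this, of "2::nat"] show ?thesis by simp
qed

text \<open>Greediness and \<open>dist_arc\<close> force the distance to drop by exactly one, and
  \<open>dist a r\<close> \<le> \<open>diam\<close> rules out truncation, so the exponent rises by
  exactly one.\<close>

lemma weight_arc_greedy:
  assumes "a \<rightarrow>\<^bsub>G\<^esub> b" "r \<in> verts G" "greedy_step G r (a, b)"
  shows "(2::nat) ^ (diam - dist b r) = 2 * 2 ^ (diam - dist a r)"
proof -
  have "a \<in> verts G" using assms(1) by auto
  then have "diam - dist b r = Suc (diam - dist a r)"
    using dist_arc[OF assms(1,2)] assms(3) dist_le_diam[of a r] assms(2)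
    by (auto simp: greedy_step_def)
  then show ?thesis by simp
qed

lemma weight_add_mset: "weight r (add_mset v D) = 2 ^ (diam - dist v r) + weight r D"
  by (simp add: weight_def)

lemma weight_step_le:
  assumes "pebbling_step G s D D'" "r \<in> verts G"
  shows "weight r D' \<le> weight r D"
proof -
  obtain a b where s: "s = (a, b)" by force
  have arc: "a \<rightarrow>\<^bsub>G\<^esub> b" and D': "D' = add_mset b (D - {#a, a#})" and "{#a, a#} \<subseteq># D"
    using assms(1) by (auto simp: s pebbling_step_def subseteq_mset_def)
  then obtain F where F: "D = add_mset a (add_mset a F)"
    by (auto simp: subset_mset.le_iff_add)
  with weight_arc_le[OF arc assms(2)] show ?thesis
    by (simp add: D' weight_add_mset)
qed

lemma weight_solvable:
  assumes "solvable G r D" "r \<in> verts G"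
  shows "2 ^ diam \<le> weight r D"
proof -
  obtain ss D' where "pebbling_sequence G D ss D'" and r: "count D' r \<ge> 1"
    using assms(1) unfolding solvable_def solution_def by blast
  then have "weight r D' \<le> weight r D"
    by (induction rule: pebbling_sequence.induct)
      (auto dest: weight_step_le[OF _ assms(2)])
  \<comment> \<open>The pebble on the root alone weighs \<open>2 ^ diam\<close>, being at distance
    0.\<close>
  moreover have "D' = add_mset r (D' - {#r#})" using r by simp
  then have "2 ^ diam \<le> weight r D'"
    by (metis weight_add_mset dist_self[OF assms(2)] diff_zero le_add1)
  ultimately show ?thesis by simp
qed

lemma greedy_exact_weight:
  assumes "pebbling_sequence G D ss D'" "\<forall>s\<in>set ss. greedy_step G r s" "r \<in># D'" "r \<in> verts G"
  shows "\<exists>E. E \<subseteq># D \<and> solvable G r E \<and> weight r E = 2 ^ diam"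
  using assms(1-3)
proof induction
  case (Nil D)
  then show ?case
    using assms(4) by (intro exI[of _ "{#r#}"]) (auto simp: solvable_root weight_def dist_self)
next
  case (Cons s D D1 ss D')
  obtain E where E: "E \<subseteq># D1" "solvable G r E" "weight r E = 2 ^ diam"
    using Cons by auto
  obtain a b where s: "s = (a, b)" by force
  have arc: "a \<rightarrow>\<^bsub>G\<^esub> b" and D1: "D1 = add_mset b (D - {#a, a#})" and aa: "{#a, a#} \<subseteq># D"
    using Cons.hyps by (auto simp: s pebbling_step_def subseteq_mset_def)
  have greedy: "greedy_step G r (a, b)" using Cons.prems by (simp add: s)
  show ?case
  proof (cases "b \<in># E")
    case False
    have "E - {#b#} \<subseteq># D - {#a, a#}" using E(1) by (simp add: D1 subset_eq_diff_conv)
    with False have "E \<subseteq># D - {#a, a#}" by simp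
    then have "E \<subseteq># D" using diff_subset_eq_self subset_mset.order_trans by blast
    with E show ?thesis by blast
  next
    case True
    then obtain F where F: "E = add_mset b F" by (blast dest: multi_member_split)
    \<comment> \<open>One \<open>b\<close> in \<open>E\<close> is taken to be the pebble just
      produced, so the rest was present beside the two pebbles consumed.\<close>
    have "F \<subseteq># D - {#a, a#}" using E(1) by (simp add: D1 F)
    then have "F + {#a, a#} \<subseteq># D"
      using aa by (simp add: subset_mset.le_diff_conv2)
    moreover have "solvable G r (F + {#a, a#})"
      by (rule solvable_step[of G "(a, b)" _ E]) (use arc E(2) in \<open>auto simp: pebbling_step_def F\<close>)
    moreover have "weight r (F + {#a, a#}) = weight r E"
      using weight_arc_greedy[OF arc assms(4) greedy] by (simp add: F weight_add_mset)
    ultimately show ?thesis using E(3) by auto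
  qed
qed

lemma size_le_weight: "size D \<le> weight r D"
proof (induction D)
  case (add v D)
  have "(1::nat) \<le> 2 ^ (diam - dist v r)" by simp
  with add show ?case unfolding weight_add_mset size_add_mset by linarith
qed simp

lemma greedy_critical_size_le:
  assumes "critical G r D" "greedy G r D" "r \<in> verts G"
  shows "size D \<le> 2 ^ diam"
proof -
  obtain ss D' where "pebbling_sequence G D ss D'" "\<forall>s\<in>set ss. greedy_step G r s" "r \<in># D'"
    using assms(2) unfolding greedy_def solution_def by (auto simp: Suc_le_eq)
  then obtain E where "E \<subseteq># D" "solvable G r E" "weight r E = 2 ^ diam"
    using greedy_exact_weight assms(3) by blast
  then show ?thesis
    using critical_subset_eq[OF assms(1)] size_le_weight by metis
qed

section \<open>Finiteness of the set of critical sizes\<close>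

lemma critical_count_le:
  assumes "critical G r D" "r \<in> verts G" "v \<in> verts G"
  shows "count D v \<le> 2 ^ diam"
proof (rule ccontr)
  assume "\<not> ?thesis"
  moreover have "(2::nat) ^ dist v r \<le> 2 ^ diam"
    by (rule power_increasing[OF dist_le_diam]) (use assms in simp_all)
  ultimately have less: "2 ^ dist v r < count D v" by (simp only: not_le)
  then have "replicate_mset (2 ^ dist v r) v \<subseteq># D"
    by (simp only: count_le_replicate_mset_subset_eq[symmetric] less_imp_le)
  \<comment> \<open>A stack of \<open>2 ^ dist v r\<close> pebbles is already solvable, so a
    critical \<open>D\<close> containing it has nothing else.\<close>
  then have "replicate_mset (2 ^ dist v r) v = D"
    using critical_subset_eq[OF assms(1)] solvable_replicate[OF assms(3,2)] by blast
  then have "count D v = 2 ^ dist v r" by (metis count_replicate_mset)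
  with less show False by (simp only: less_irrefl)
qed

text \<open>Needed for the \<open>Max\<close> in \<open>critical_number\<close> to be an actual
  maximum; the bound per vertex is summed over the support of \<open>D\<close>.\<close>

lemma finite_critical_sizes: "finite {size D |r D. rooted_distribution G r D \<and> critical G r D}"
proof -
  have "size D \<le> card (verts G) * 2 ^ diam"
    if D: "rooted_distribution G r D" "critical G r D" for r D
  proof -
    have V: "r \<in> verts G" "set_mset D \<subseteq> verts G"
      using D by (auto simp: rooted_distribution_def)
    have "size D = (\<Sum>v\<in>set_mset D. count D v)" by (rule size_multiset_overloaded_eq)
    also have "\<dots> \<le> (\<Sum>v\<in>set_mset D. 2 ^ diam)"
      using V D critical_count_le by (intro sum_mono) blast
    also have "\<dots> = card (set_mset D) * 2 ^ diam" by simp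
    also have "\<dots> \<le> card (verts G) * 2 ^ diam"
      using V by (intro mult_right_mono card_mono) auto
    finally show ?thesis .
  qed
  then show ?thesis
    by (intro finite_subset[OF _ finite_atMost[of "card (verts G) * 2 ^ diam"]]) blast
qed

text \<open>At distance \<open>diam\<close> each pebble weighs exactly 1, so the stack just reaches
  the minimal weight of a solvable distribution and losing any pebble falls short of it.\<close>

lemma critical_replicate:
  assumes "u \<in> verts G" "r \<in> verts G" "dist u r = diam"
  shows "critical G r (replicate_mset (2 ^ diam) u)"
proof -
  have "\<not> solvable G r (replicate_mset (2 ^ diam) u - {#u#})"
  proof
    assume "solvable G r (replicate_mset (2 ^ diam) u - {#u#})"
    from weight_solvable[OF this assms(2)]
    have "2 ^ diam \<le> weight r (replicate_mset (2 ^ diam) u - {#u#})" .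
    moreover have "replicate_mset (2 ^ diam) u = add_mset u (replicate_mset (2 ^ diam) u - {#u#})"
      by simp
    then have "weight r (replicate_mset (2 ^ diam) u)
        = Suc (weight r (replicate_mset (2 ^ diam) u - {#u#}))"
      by (metis weight_add_mset assms(3) diff_self_eq_0 power_0 plus_1_eq_Suc)
    ultimately show False by (simp add: weight_def assms(3))
  qed
  then show ?thesis
    using solvable_replicate[OF assms(1,2)] assms(3) by (auto simp: critical_def)
qed

section \<open>Both bounds on the critical number\<close>

lemma diam_critical_size:
  "2 ^ diam \<in> {size D |r D. rooted_distribution G r D \<and> critical G r D}"
proof -
  obtain u r where "u \<in> verts G" "r \<in> verts G" "dist u r = diam" using diam_attained .
  then show ?thesis
    using critical_replicate[of u r]
    by (intro CollectI exI[of _ r] exI[of _ "replicate_mset (2 ^ diam) u"])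
      (auto simp: rooted_distribution_def)
qed

text \<open>Thriftiness quantifies over all ceiling distributions, so one must exist before the
  greedy size bound says anything about \<open>critical_number\<close>.\<close>

lemma ceiling_exists: "\<exists>r D. ceiling_distribution G r D"
proof -
  have "critical_number G \<in> {size D |r D. rooted_distribution G r D \<and> critical G r D}"
    unfolding critical_number_def using diam_critical_size
    by (intro Max_in[OF finite_critical_sizes]) blast
  then show ?thesis unfolding ceiling_distribution_def by (simp, metis)
qed

lemma thrifty_critical_number:
  assumes "thrifty G"
  shows "critical_number G = 2 ^ diam"
proof (rule antisym)
  obtain r D where D: "ceiling_distribution G r D" using ceiling_exists by blast
  with assms have "greedy G r D" by (simp add: thrifty_def)
  with D show "critical_number G \<le> 2 ^ diam"
    using greedy_critical_size_le[of r D]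
    by (simp add: ceiling_distribution_def rooted_distribution_def)
  \<comment> \<open>The stack at distance \<open>diam\<close> competes in the maximum.\<close>
  show "2 ^ diam \<le> critical_number G"
    unfolding critical_number_def by (rule Max_ge[OF finite_critical_sizes diam_critical_size])
qed

end

theorem theorem15:
  fixes G :: "('v, 'e) pre_digraph" and d :: nat
  assumes "graph G"
    and "Digraph_Component.connected G"
    and "thrifty G"
    and "graph_diameter G = d"
  shows "critical_number G = 2 ^ d"
proof -
  interpret graph G by fact
  interpret connected_graph G by unfold_locales fact
  show ?thesis using thrifty_critical_number assms(3,4) by simp
qed

end
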